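(* Let $V$ be a non-trivial real or complex vector space equipped with inner products $\langle\cdot,\cdot\rangle_1$ and $\langle\cdot,\cdot\rangle_2$, and let $m$, $M$ and $E$ be as defined in the context. For (linearly) independent vectors $u$ and $v$ in $V$ let $\Phi$ and $\Psi$ be defined by $0\le\Phi\le\pi/2$, $0\le\Psi\le\pi/2$, \[ \cos\Phi=\frac{|\langle u,v\rangle_1|}{\|u\|_1\|v\|_1}\quad\text{and}\quad\cos\Psi=\frac{|\langle u,v\rangle_2|}{\|u\|_2\|v\|_2}. \] Then \[ (m/M)\tan(\Phi/2)\le\tan(\Psi/2)\le (M/m)\tan(\Phi/2). \] Let $\alpha_1$ and $\alpha_2$ be scalars with $|\alpha_1|=|\alpha_2|=1$ that satisfy $|\langle u,v\rangle_1|=\alpha_1\langle u,v\rangle_1$ and $|\langle u,v\rangle_2|=\alpha_2\langle u,v\rangle_2$. Equality holds in the right-hand inequality if and only if $(\alpha_1u,v)\in E$ and either $\alpha_1=\alpha_2$ or $\langle u,v\rangle_2=0$. Equality holds in the left-hand inequality if and only if $(\alpha_2u,-v)\in E$ and either $\alpha_1=\alpha_2$ or $\langle u,v\rangle_1=0$.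
   Context: $V$ may be infinite-dimensional. Inner products are over the scalar field of $V$ (real or complex) and linear in the first variable; $\|v\|_j=\sqrt{\langle v,v\rangle_j}$ for $j=1,2$. Scalars $\alpha_1,\alpha_2$ lie in the scalar field of $V$ (so they are $\pm1$ in the real case). Define \[ m=\inf_{0\ne v\in V}\frac{\|v\|_2}{\|v\|_1},\quad V_m=\{v\in V:\|v\|_2=m\|v\|_1\},\quad M=\sup_{0\ne v\in V}\frac{\|v\|_2}{\|v\|_1},\quad V_M=\{v\in V:\|v\|_2=M\|v\|_1\}, \] so $0\le m\le M\le\infty$, with the convention $0\cdot\infty=0$ (so $0\in V_M$ when $M=\infty$). For $j=1,2$ let \[ E_j=\Big\{(u,v): u,v\in V\setminus\{0\},\ \frac{u}{\|u\|_j}+\frac{v}{\|v\|_j}\in V_m,\ \frac{u}{\|u\|_j}-\frac{v}{\|v\|_j}\in V_M\Big\}. \] The sets $E_1$ and $E_2$ coincide, and $E$ denotes this common set. If $m=0$ or $M=\infty$, then $m/M$ is read as $0$ and $M/m$ as $+\infty$. *)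

theory Defs
  imports Complex_Main "HOL-Library.Extended_Real"
begin

text \<open>
  The scalar field: \<^typ>\<open>real\<close> and \<^typ>\<open>complex\<close> are instances. The axioms give
  that scalar\_cnj fixes the reals and that \<open>x + scalar_cnj x\<close> is real, so every scalar is a root
  of the real quadratic \<open>(X - x) (X - scalar_cnj x)\<close>; up to isomorphism there are no other instances.
\<close>

class real_or_complex = real_normed_field +
  fixes scalar_cnj :: "'a \<Rightarrow> 'a"
  assumes scalar_cnj_add: "scalar_cnj (x + y) = scalar_cnj x + scalar_cnj y"
    and scalar_cnj_mult: "scalar_cnj (x * y) = scalar_cnj x * scalar_cnj y"
    and scalar_cnj_cnj: "scalar_cnj (scalar_cnj x) = x"
    and mult_scalar_cnj': "x * scalar_cnj x = (norm x)\<^sup>2 *\<^sub>R 1"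

lemma mult_scalar_cnj: "x * scalar_cnj x = of_real ((norm x)\<^sup>2)" for x :: "'k::real_or_complex"
  by (simp add: mult_scalar_cnj' of_real_def)

instantiation real :: real_or_complex
begin

definition scalar_cnj_real :: "real \<Rightarrow> real" where
  "scalar_cnj_real x = x"

instance
  by standard (simp_all add: scalar_cnj_real_def power2_eq_square)

end

instantiation complex :: real_or_complex
begin

definition scalar_cnj_complex :: "complex \<Rightarrow> complex" where
  "scalar_cnj_complex z = cnj z"

instance
  by standard (simp_all add: scalar_cnj_complex_def complex_norm_square[symmetric] scaleR_conv_of_real)

end

lemma scalar_cnj_of_real: "scalar_cnj (of_real r :: 'k::real_or_complex) = of_real r"
proof (cases "r = 0")
  case True
  have "scalar_cnj (0::'k) + scalar_cnj 0 = scalar_cnj 0"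
    by (metis add.right_neutral scalar_cnj_add)
  then show ?thesis using True by simp
next
  case False
  have "of_real r * scalar_cnj (of_real r :: 'k) = of_real r * of_real r"
    using mult_scalar_cnj[of "of_real r :: 'k"] by (simp add: power2_eq_square flip: of_real_mult)
  then show ?thesis using False by simp
qed

locale inner_product_space = vector_space scale
  for scale :: "'k::real_or_complex \<Rightarrow> 'v::ab_group_add \<Rightarrow> 'v" +
  fixes ip :: "'v \<Rightarrow> 'v \<Rightarrow> 'k"
  assumes ip_add_left: "ip (u + v) w = ip u w + ip v w"
    and ip_scale_left: "ip (scale c u) w = c * ip u w"
    and ip_commute: "ip v u = scalar_cnj (ip u v)"
    and ip_pos: "v \<noteq> 0 \<Longrightarrow> \<exists>r>0. ip v v = of_real r"

text \<open>For an inner product, \<open>ip v v\<close> is a nonnegative real scalar, hence equal to its modulus.\<close>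

definition ip_norm :: "('v \<Rightarrow> 'v \<Rightarrow> 'k::real_or_complex) \<Rightarrow> 'v \<Rightarrow> real" where
  "ip_norm ip v = sqrt (norm (ip v v))"

definition ratio_inf ::
  "('v::ab_group_add \<Rightarrow> 'v \<Rightarrow> 'k::real_or_complex) \<Rightarrow> ('v \<Rightarrow> 'v \<Rightarrow> 'k) \<Rightarrow> ereal" where
  "ratio_inf ip1 ip2 = (INF v\<in>{v. v \<noteq> 0}. ereal (ip_norm ip2 v / ip_norm ip1 v))"

definition ratio_sup ::
  "('v::ab_group_add \<Rightarrow> 'v \<Rightarrow> 'k::real_or_complex) \<Rightarrow> ('v \<Rightarrow> 'v \<Rightarrow> 'k) \<Rightarrow> ereal" where
  "ratio_sup ip1 ip2 = (SUP v\<in>{v. v \<noteq> 0}. ereal (ip_norm ip2 v / ip_norm ip1 v))"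

text \<open>
  \<open>V\<^sub>m\<close> and \<open>V\<^sub>M\<close>. In \<^typ>\<open>ereal\<close>, \<open>\<infinity> * 0 = 0\<close>, so \<open>0\<close> lies in
  \<open>V\<^sub>M\<close> also when \<open>M = \<infinity>\<close>.
\<close>

definition inf_set ::
  "('v::ab_group_add \<Rightarrow> 'v \<Rightarrow> 'k::real_or_complex) \<Rightarrow> ('v \<Rightarrow> 'v \<Rightarrow> 'k) \<Rightarrow> 'v set" where
  "inf_set ip1 ip2 = {v. ereal (ip_norm ip2 v) = ratio_inf ip1 ip2 * ereal (ip_norm ip1 v)}"

definition sup_set ::
  "('v::ab_group_add \<Rightarrow> 'v \<Rightarrow> 'k::real_or_complex) \<Rightarrow> ('v \<Rightarrow> 'v \<Rightarrow> 'k) \<Rightarrow> 'v set" where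
  "sup_set ip1 ip2 = {v. ereal (ip_norm ip2 v) = ratio_sup ip1 ip2 * ereal (ip_norm ip1 v)}"

definition ip_normalize ::
  "('k::real_or_complex \<Rightarrow> 'v \<Rightarrow> 'v) \<Rightarrow> ('v \<Rightarrow> 'v \<Rightarrow> 'k) \<Rightarrow> 'v \<Rightarrow> 'v" where
  "ip_normalize scale ip v = scale (of_real (1 / ip_norm ip v)) v"

text \<open>
  The set \<open>E\<^sub>j\<close>: the last argument \<open>ip\<close> is the inner product used for normalization,
  to be taken as \<open>ip1\<close> or \<open>ip2\<close>.
\<close>

definition extremal_pairs_wrt ::
  "('k::real_or_complex \<Rightarrow> 'v::ab_group_add \<Rightarrow> 'v) \<Rightarrow> ('v \<Rightarrow> 'v \<Rightarrow> 'k) \<Rightarrow> ('v \<Rightarrow> 'v \<Rightarrow> 'k) \<Rightarrow>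
    ('v \<Rightarrow> 'v \<Rightarrow> 'k) \<Rightarrow> ('v \<times> 'v) set" where
  "extremal_pairs_wrt scale ip1 ip2 ip =
    {(u, v). u \<noteq> 0 \<and> v \<noteq> 0 \<and>
      ip_normalize scale ip u + ip_normalize scale ip v \<in> inf_set ip1 ip2 \<and>
      ip_normalize scale ip u - ip_normalize scale ip v \<in> sup_set ip1 ip2}"

text \<open>
  The common set \<open>E = E\<^sub>1 = E\<^sub>2\<close>, defined as \<open>E\<^sub>1\<close>; the agreement with \<open>E\<^sub>2\<close> is the
  lemma extremal\_pairs\_eq\_wrt\_ip2 below.
\<close>

definition extremal_pairs ::
  "('k::real_or_complex \<Rightarrow> 'v::ab_group_add \<Rightarrow> 'v) \<Rightarrow> ('v \<Rightarrow> 'v \<Rightarrow> 'k) \<Rightarrow> ('v \<Rightarrow> 'v \<Rightarrow> 'k) \<Rightarrow>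
    ('v \<times> 'v) set" where
  "extremal_pairs scale ip1 ip2 = extremal_pairs_wrt scale ip1 ip2 ip1"

context inner_product_space
begin

lemma ip_add_right: "ip w (u + v) = ip w u + ip w v"
  by (metis ip_add_left ip_commute scalar_cnj_add)

lemma ip_scale_of_real_right: "ip w (scale (of_real r) u) = of_real r * ip w u"
  by (metis ip_commute ip_scale_left scalar_cnj_mult scalar_cnj_of_real)

lemma ip_diff_left: "ip (u - v) w = ip u w - ip v w"
  by (metis add_diff_cancel_right' diff_add_cancel ip_add_left)

lemma ip_diff_right: "ip w (u - v) = ip w u - ip w v"
  by (metis add_diff_cancel_right' diff_add_cancel ip_add_right)

lemma ip_zero: "ip 0 0 = 0"
  using ip_scale_left[of 0 0 0] by simp

lemma of_real_ip_norm_sq: "of_real ((ip_norm ip v)\<^sup>2) = ip v v"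
proof (cases "v = 0")
  case True
  then show ?thesis by (simp add: ip_norm_def ip_zero)
next
  case False
  then obtain r where "r > 0" "ip v v = of_real r" using ip_pos by blast
  then show ?thesis by (simp add: ip_norm_def)
qed

lemma ip_norm_nonneg: "0 \<le> ip_norm ip v"
  by (simp add: ip_norm_def)

lemma ip_norm_pos: "v \<noteq> 0 \<Longrightarrow> 0 < ip_norm ip v"
  using ip_pos[of v] by (auto simp: ip_norm_def)

lemma ip_norm_zero: "ip_norm ip 0 = 0"
  by (simp add: ip_norm_def ip_zero)

lemma ip_norm_scale: "ip_norm ip (scale (of_real r) v) = \<bar>r\<bar> * ip_norm ip v"
  by (simp add: ip_norm_def ip_scale_left ip_scale_of_real_right norm_mult real_sqrt_mult
      flip: mult.assoc)

lemma ip_norm_comb: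
  "(ip_norm ip ((a + b) + scale (of_real t) (a - b)))\<^sup>2 =
     (ip_norm ip (a + b))\<^sup>2 + t * (2 * ((ip_norm ip a)\<^sup>2 - (ip_norm ip b)\<^sup>2))
       + t\<^sup>2 * (ip_norm ip (a - b))\<^sup>2"
proof -
  have "(of_real ((ip_norm ip ((a + b) + scale (of_real t) (a - b)))\<^sup>2) :: 'k) =
    of_real ((ip_norm ip (a + b))\<^sup>2 + t * (2 * ((ip_norm ip a)\<^sup>2 - (ip_norm ip b)\<^sup>2))
       + t\<^sup>2 * (ip_norm ip (a - b))\<^sup>2)"
    unfolding of_real_add of_real_diff of_real_mult of_real_ip_norm_sq
    unfolding ip_add_left ip_add_right ip_scale_left ip_scale_of_real_right
      ip_diff_left ip_diff_right
    by (simp add: algebra_simps power2_eq_square)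
  then show ?thesis using of_real_eq_iff by blast
qed

end

lemma linear_coeff_zero:
  fixes c d :: real
  assumes "\<And>t. 0 \<le> t * c + t\<^sup>2 * d"
  shows "c = 0"
proof (rule ccontr)
  assume c: "c \<noteq> 0"
  define t where "t = - c / (\<bar>d\<bar> + 1)"
  have t: "t * (\<bar>d\<bar> + 1) = - c" by (simp add: t_def add_pos_nonneg[of 1] add.commute)
  have "t \<noteq> 0" using c t by auto
  have "t * c + t\<^sup>2 * d = t\<^sup>2 * (d - \<bar>d\<bar> - 1)"
  proof -
    have "t * c = - (t * (t * (\<bar>d\<bar> + 1)))" using t by simp
    then show ?thesis by (simp add: algebra_simps power2_eq_square)
  qed
  also have "\<dots> < 0" using \<open>t \<noteq> 0\<close> by (intro mult_pos_neg) auto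
  finally show False using assms[of t] by simp
qed

locale two_inner_products =
  I1: inner_product_space scale ip1 + I2: inner_product_space scale ip2
  for scale :: "'k::real_or_complex \<Rightarrow> 'v::ab_group_add \<Rightarrow> 'v" and ip1 ip2
begin

lemma inf_set_normalized_eq:
  assumes x: "a + b \<in> inf_set ip1 ip2" and ne: "a \<noteq> 0"
  shows "ip_norm ip1 a = ip_norm ip1 b \<longleftrightarrow> ip_norm ip2 a = ip_norm ip2 b"
proof -
  have lb: "ratio_inf ip1 ip2 \<le> ereal (ip_norm ip2 v / ip_norm ip1 v)" if "v \<noteq> 0" for v
    unfolding ratio_inf_def using that by (intro INF_lower) auto
  have ge0: "0 \<le> ratio_inf ip1 ip2"
    unfolding ratio_inf_def by (intro INF_greatest) (simp add: I1.ip_norm_nonneg I2.ip_norm_nonneg)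
  obtain r where r: "ratio_inf ip1 ip2 = ereal r" "0 \<le> r"
    using ge0 lb[OF ne] by (cases "ratio_inf ip1 ip2") auto
  have le: "r * ip_norm ip1 v \<le> ip_norm ip2 v" for v
    using lb[of v] r I1.ip_norm_pos[of v]
    by (cases "v = 0") (auto simp: field_simps I1.ip_norm_zero I2.ip_norm_zero)
  have sq: "r\<^sup>2 * (ip_norm ip1 v)\<^sup>2 \<le> (ip_norm ip2 v)\<^sup>2" for v
    using power_mono[OF le[of v], of 2] r(2) I1.ip_norm_nonneg[of v] by (simp add: power_mult_distrib)
  have eq: "ip_norm ip2 (a + b) = r * ip_norm ip1 (a + b)"
    using x r by (simp add: inf_set_def)
  let ?c1 = "2 * ((ip_norm ip1 a)\<^sup>2 - (ip_norm ip1 b)\<^sup>2)"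
  let ?c2 = "2 * ((ip_norm ip2 a)\<^sup>2 - (ip_norm ip2 b)\<^sup>2)"
  have "?c2 - r\<^sup>2 * ?c1 = 0"
  proof (rule linear_coeff_zero)
    fix t
    show "0 \<le> t * (?c2 - r\<^sup>2 * ?c1)
        + t\<^sup>2 * ((ip_norm ip2 (a - b))\<^sup>2 - r\<^sup>2 * (ip_norm ip1 (a - b))\<^sup>2)"
      using sq[of "(a + b) + scale (of_real t) (a - b)"]
      unfolding I1.ip_norm_comb I2.ip_norm_comb eq
      by (simp add: algebra_simps power_mult_distrib)
  qed
  then have c: "(ip_norm ip2 a)\<^sup>2 - (ip_norm ip2 b)\<^sup>2
      = r\<^sup>2 * ((ip_norm ip1 a)\<^sup>2 - (ip_norm ip1 b)\<^sup>2)"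
    by (simp add: algebra_simps)
  have pe: "p = q \<longleftrightarrow> p\<^sup>2 - q\<^sup>2 = 0" if "0 \<le> p" "0 \<le> q" for p q :: real
    using that by (simp add: power2_eq_iff_nonneg)
  show ?thesis
  proof (cases "r = 0")
    case True
    then have "a + b = 0" using eq I2.ip_norm_pos[of "a + b"] by auto
    then have "a = scale (of_real (-1)) b" by (simp add: eq_neg_iff_add_eq_0)
    then show ?thesis
      using I1.ip_norm_scale[of "-1" b] I2.ip_norm_scale[of "-1" b] by simp
  next
    case False
    then show ?thesis
      using c pe[OF I1.ip_norm_nonneg I1.ip_norm_nonneg, of a b]
        pe[OF I2.ip_norm_nonneg I2.ip_norm_nonneg, of a b]
      by auto
  qed
qed

lemma scale_inf_set: "x \<in> inf_set ip1 ip2 \<Longrightarrow> scale (of_real r) x \<in> inf_set ip1 ip2"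
  by (simp add: inf_set_def I1.ip_norm_scale I2.ip_norm_scale mult.left_commute flip: times_ereal.simps)

lemma scale_sup_set: "x \<in> sup_set ip1 ip2 \<Longrightarrow> scale (of_real r) x \<in> sup_set ip1 ip2"
  by (simp add: sup_set_def I1.ip_norm_scale I2.ip_norm_scale mult.left_commute flip: times_ereal.simps)

lemma normalize_change:
  assumes sub: "(ipa = ip1 \<and> ipb = ip2) \<or> (ipa = ip2 \<and> ipb = ip1)"
  shows "extremal_pairs_wrt scale ip1 ip2 ipa \<subseteq> extremal_pairs_wrt scale ip1 ip2 ipb"
proof clarify
  fix u v assume uv: "(u, v) \<in> extremal_pairs_wrt scale ip1 ip2 ipa"
  interpret A: inner_product_space scale ipa using sub I1.inner_product_space_axioms I2.inner_product_space_axioms by auto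
  interpret B: inner_product_space scale ipb using sub I1.inner_product_space_axioms I2.inner_product_space_axioms by auto
  define a where "a = ip_normalize scale ipa u"
  define b where "b = ip_normalize scale ipa v"
  have nz: "u \<noteq> 0" "v \<noteq> 0" and x: "a + b \<in> inf_set ip1 ip2" and y: "a - b \<in> sup_set ip1 ip2"
    using uv by (auto simp: extremal_pairs_wrt_def a_def b_def)
  note pos = A.ip_norm_pos[OF nz(1)] A.ip_norm_pos[OF nz(2)] B.ip_norm_pos[OF nz(1)] B.ip_norm_pos[OF nz(2)]
  have nA: "ip_norm ipa a = 1" "ip_norm ipa b = 1"
    using pos unfolding a_def b_def ip_normalize_def A.ip_norm_scale by simp_all
  have nB: "ip_norm ipb a = ip_norm ipb u / ip_norm ipa u" "ip_norm ipb b = ip_norm ipb v / ip_norm ipa v"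
    using pos unfolding a_def b_def ip_normalize_def B.ip_norm_scale by simp_all
  have "a \<noteq> 0" using nA A.ip_norm_zero by auto
  then have k: "ip_norm ipb a = ip_norm ipb b"
    using inf_set_normalized_eq[OF x] nA sub by auto
  define s where "s = 1 / ip_norm ipb a"
  have au: "ip_normalize scale ipb u = scale (of_real s) a"
    using pos unfolding s_def nB(1) by (simp add: a_def ip_normalize_def flip: of_real_mult of_real_divide)
  have bv: "ip_normalize scale ipb v = scale (of_real s) b"
    using pos unfolding s_def k nB(2) by (simp add: b_def ip_normalize_def flip: of_real_mult of_real_divide)
  show "(u, v) \<in> extremal_pairs_wrt scale ip1 ip2 ipb"
    using nz scale_inf_set[OF x, of s] scale_sup_set[OF y, of s]
    by (simp add: extremal_pairs_wrt_def au bv I1.scale_right_distrib I1.scale_right_diff_distrib)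
qed

lemma extremal_pairs_eq_wrt_ip2:
  "extremal_pairs scale ip1 ip2 = extremal_pairs_wrt scale ip1 ip2 ip2"
  unfolding extremal_pairs_def using normalize_change by blast

end

end

theory Submission
  imports Defs
begin

text \<open>
  Let \<open>u\<close> and \<open>v\<close> be independent. In any inner product, \<open>tan (\<theta> / 2)\<close>, for \<open>\<theta>\<close> the angle
  between the lines through \<open>u\<close> and \<open>v\<close>, is the minimum of \<open>\<parallel>a - b\<parallel> / \<parallel>a + b\<parallel>\<close> over the nonzero multiples \<open>a\<close> of \<open>u\<close> and
  \<open>b\<close> of \<open>v\<close>. For multiples of equal norm, the minimum is attained exactly when \<open>\<langle>a, b\<rangle> \<ge> 0\<close>
  (lemmas \<open>tan_half_le\<close>, \<open>tan_half_eq_iff\<close>).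

  For the right-hand inequality, let \<open>a = \<alpha>1 u / \<parallel>u\<parallel>\<^sub>1\<close> and \<open>b = v / \<parallel>v\<parallel>\<^sub>1\<close>, which is a
  minimizing pair for the first inner product. With \<open>\<rho>(w) = \<parallel>w\<parallel>\<^sub>2 / \<parallel>w\<parallel>\<^sub>1\<close>,
  \[ \frac{\tan (\Psi/2)}{\tan (\Phi/2)} \le
     \frac{\|a-b\|_2 / \|a+b\|_2}{\|a-b\|_1 / \|a+b\|_1}
     = \frac{\rho(a-b)}{\rho(a+b)} \le \frac Mm . \]
  The last step is an equality exactly when \<open>a + b \<in> V\<^sub>m\<close> and \<open>a - b \<in> V\<^sub>M\<close>, that is
  \<open>(\<alpha>1 u, v) \<in> E\<close>. In that case \<open>\<parallel>a\<parallel>\<^sub>2 = \<parallel>b\<parallel>\<^sub>2\<close> (lemma \<open>inf_set_normalized_eq\<close>), so the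
  first step is an equality exactly when \<open>\<langle>a, b\<rangle>\<^sub>2 \<ge> 0\<close>, that is \<open>\<alpha>1 = \<alpha>2\<close> or
  \<open>\<langle>u, v\<rangle>\<^sub>2 = 0\<close>. The left-hand inequality is obtained in the same way from
  \<open>a = \<alpha>2 u / \<parallel>u\<parallel>\<^sub>2\<close> and \<open>b = v / \<parallel>v\<parallel>\<^sub>2\<close>, a minimizing pair for the second inner
  product, with the chain of inequalities reversed and \<open>\<rho>(a - b) / \<rho>(a + b) \<ge> m / M\<close>.
\<close>

section \<open>Quotients of extended reals\<close>

lemma ereal_le_mult_iff:
  assumes "0 < t"
  shows "ereal s \<le> K * ereal t \<longleftrightarrow> ereal (s / t) \<le> K"
  using assms by (cases K) (auto simp: field_simps)

lemma ereal_mult_le_iff: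
  assumes "0 < t"
  shows "K * ereal t \<le> ereal s \<longleftrightarrow> K \<le> ereal (s / t)"
  using assms by (cases K) (auto simp: field_simps)

lemma ereal_eq_mult_iff:
  assumes "0 < t"
  shows "ereal s = K * ereal t \<longleftrightarrow> ereal (s / t) = K"
  using assms by (cases K) (auto simp: field_simps)

text \<open>The cases \<open>m = 0\<close> and \<open>M = \<infinity>\<close> are included; the bounds are strict in both.\<close>

lemma ereal_quotient_bounds:
  fixes m M :: ereal and r s :: real
  assumes m: "0 \<le> m" "m \<le> ereal r" "m \<le> ereal s"
    and M: "ereal r \<le> M" "ereal s \<le> M" and pos: "0 < r" "0 < s"
  shows "ereal (s / r) \<le> M / m"
    and "ereal (s / r) = M / m \<longleftrightarrow> ereal r = m \<and> ereal s = M"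
    and "m / M \<le> ereal (s / r)"
    and "m / M = ereal (s / r) \<longleftrightarrow> ereal s = m \<and> ereal r = M"
proof -
  obtain m' where m': "m = ereal m'" using m by (cases m) auto
  have "M = \<infinity> \<or> (\<exists>M'. M = ereal M')" using M by (cases M) auto
  then consider (inf) "M = \<infinity>" | (zero) M' where "M = ereal M'" "m' = 0"
    | (fin) M' where "M = ereal M'" "0 < m'"
    using m(1) m' by fastforce
  then have "ereal (s / r) \<le> M / m \<and> (ereal (s / r) = M / m \<longleftrightarrow> ereal r = m \<and> ereal s = M)
    \<and> m / M \<le> ereal (s / r) \<and> (m / M = ereal (s / r) \<longleftrightarrow> ereal s = m \<and> ereal r = M)"
  proof cases
    case inf
    then show ?thesis using m pos m'
      by (cases "m' = 0") auto
  next
    case zero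
    then show ?thesis using M pos m' by auto
  next
    case fin
    have le: "m' \<le> r" "m' \<le> s" "r \<le> M'" "s \<le> M'" using m M m' fin by auto
    have eq: "p * q = p' * q' \<longleftrightarrow> p = p' \<and> q = q'"
      if "0 < p" "p \<le> p'" "0 < q" "q \<le> q'" for p p' q q' :: real
      using that mult_less_le_imp_less[of p p' q q'] mult_le_less_imp_less[of p p' q q']
      by (smt (verit))
    have "s * m' \<le> M' * r" "m' * r \<le> s * M'"
      using le pos fin by (auto intro!: mult_mono)
    moreover have "s * m' = M' * r \<longleftrightarrow> s = M' \<and> m' = r" "m' * r = s * M' \<longleftrightarrow> m' = s \<and> r = M'"
      using eq[of s M' m' r] eq[of m' s r M'] le pos fin by auto
    ultimately show ?thesis
      using le pos fin m' by (auto simp: frac_le_eq frac_eq_eq divide_simps mult.commute)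
  qed
  then show "ereal (s / r) \<le> M / m"
    and "ereal (s / r) = M / m \<longleftrightarrow> ereal r = m \<and> ereal s = M"
    and "m / M \<le> ereal (s / r)"
    and "m / M = ereal (s / r) \<longleftrightarrow> ereal s = m \<and> ereal r = M"
    by blast+
qed


section \<open>The half-angle tangent in an inner product space\<close>

lemma ex_unimodular_align:
  fixes x :: "'k::real_or_complex"
  obtains \<alpha> where "norm \<alpha> = 1" "of_real (norm x) = \<alpha> * x"
proof (cases "x = 0")
  case True
  then show ?thesis using that[of 1] by simp
next
  case False
  then show ?thesis using that[of "of_real (norm x) / x"] by (simp add: norm_divide)
qed

context inner_product_space
begin

lemma ip_norm_unimodular:
  assumes "norm \<alpha> = 1"
  shows "ip_norm ip (scale \<alpha> v) = ip_norm ip v"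
proof -
  have "ip v (scale \<alpha> v) = scalar_cnj \<alpha> * ip v v"
    by (metis ip_commute ip_scale_left scalar_cnj_mult)
  then have "ip (scale \<alpha> v) (scale \<alpha> v) = ip v v"
    using mult_scalar_cnj[of \<alpha>] assms by (simp add: ip_scale_left flip: mult.assoc)
  then show ?thesis by (simp add: ip_norm_def)
qed

lemma parallelogram:
  "(ip_norm ip (a + b))\<^sup>2 + (ip_norm ip (a - b))\<^sup>2 = 2 * ((ip_norm ip a)\<^sup>2 + (ip_norm ip b)\<^sup>2)"
proof -
  have "(of_real ((ip_norm ip (a + b))\<^sup>2 + (ip_norm ip (a - b))\<^sup>2) :: 'k)
      = of_real (2 * ((ip_norm ip a)\<^sup>2 + (ip_norm ip b)\<^sup>2))"
    unfolding of_real_add of_real_mult of_real_ip_norm_sq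
    by (simp add: ip_add_left ip_add_right ip_diff_left ip_diff_right algebra_simps)
  then show ?thesis using of_real_eq_iff by blast
qed

text \<open>
  The left-hand side is \<open>4 Re \<langle>a, b\<rangle>\<close>, so this is \<open>Re z \<le> |z|\<close> with its case of equality.
\<close>

lemma polarization_le:
  shows "(ip_norm ip (a + b))\<^sup>2 - (ip_norm ip (a - b))\<^sup>2 \<le> 4 * norm (ip a b)" (is "?d \<le> 4 * ?n")
    and "(ip_norm ip (a + b))\<^sup>2 - (ip_norm ip (a - b))\<^sup>2 = 4 * norm (ip a b)
           \<longleftrightarrow> ip a b = of_real (norm (ip a b))"
proof -
  let ?z = "ip a b"
  have d: "(of_real ?d :: 'k) = 2 * (?z + scalar_cnj ?z)"
    unfolding of_real_diff of_real_ip_norm_sq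
    by (simp add: ip_add_left ip_add_right ip_diff_left ip_diff_right algebra_simps
        ip_commute[of b a, symmetric])
  have minus: "scalar_cnj (?z - of_real ?n) = scalar_cnj ?z - of_real ?n"
    using scalar_cnj_add[of "?z - of_real ?n" "of_real ?n"] by (simp add: scalar_cnj_of_real)
  \<comment> \<open>Expand \<open>|z - |z||\<^sup>2 = 2 |z| (|z| - Re z)\<close>, with \<open>?d = 4 Re z\<close>.\<close>
  have "(of_real (2 * (norm (?z - of_real ?n))\<^sup>2) :: 'k)
      = 2 * ((?z - of_real ?n) * (scalar_cnj ?z - of_real ?n))"
    using mult_scalar_cnj[of "?z - of_real ?n"] by (simp add: minus)
  also have "\<dots> = 2 * (?z * scalar_cnj ?z) + 2 * (of_real ?n)\<^sup>2
      - of_real ?n * (2 * (?z + scalar_cnj ?z))"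
    by (simp add: algebra_simps power2_eq_square)
  also have "\<dots> = of_real (?n * (4 * ?n - ?d))"
    unfolding mult_scalar_cnj d[symmetric] by (simp add: algebra_simps power2_eq_square)
  finally have key: "2 * (norm (?z - of_real ?n))\<^sup>2 = ?n * (4 * ?n - ?d)"
    using of_real_eq_iff by blast
  have zero: "?d = 0" if "?z = 0"
  proof -
    have "scalar_cnj ?z = 0" using that scalar_cnj_of_real[of 0] by simp
    then show ?thesis using d that by (simp flip: of_real_diff of_real_power)
  qed
  have ge: "0 \<le> ?n * (4 * ?n - ?d)" unfolding key[symmetric] by simp
  show "?d \<le> 4 * ?n"
  proof (cases "?z = 0")
    case False
    then have "0 \<le> 4 * ?n - ?d" using ge by (simp add: zero_le_mult_iff)
    then show ?thesis by simp
  qed (use zero in simp)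
  show "?d = 4 * ?n \<longleftrightarrow> ?z = of_real ?n"
  proof (cases "?z = 0")
    case False
    have "?z = of_real ?n \<longleftrightarrow> 2 * (norm (?z - of_real ?n))\<^sup>2 = 0" by simp
    also have "\<dots> \<longleftrightarrow> ?d = 4 * ?n" unfolding key using False by auto
    finally show ?thesis by blast
  qed (use zero in simp)
qed

text \<open>
  By the parallelogram law this only restates
  \<open>tan\<^sup>2 (\<theta> / 2) = (1 - cos \<theta>) / (1 + cos \<theta>)\<close>; the angle need not be related to \<open>a\<close> and \<open>b\<close>.
\<close>

lemma tan_half_cmp:
  assumes th: "0 \<le> \<theta>" "\<theta> \<le> pi / 2"
  shows "tan (\<theta> / 2) * ip_norm ip (a + b) \<le> ip_norm ip (a - b) \<longleftrightarrow>
      (ip_norm ip (a + b))\<^sup>2 - (ip_norm ip (a - b))\<^sup>2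
        \<le> 2 * cos \<theta> * ((ip_norm ip a)\<^sup>2 + (ip_norm ip b)\<^sup>2)"
    and "tan (\<theta> / 2) * ip_norm ip (a + b) = ip_norm ip (a - b) \<longleftrightarrow>
      (ip_norm ip (a + b))\<^sup>2 - (ip_norm ip (a - b))\<^sup>2
        = 2 * cos \<theta> * ((ip_norm ip a)\<^sup>2 + (ip_norm ip b)\<^sup>2)"
proof -
  let ?P = "ip_norm ip (a + b)" and ?Q = "ip_norm ip (a - b)" and ?T = "tan (\<theta> / 2)"
  have c: "0 \<le> cos \<theta>" using th by (intro cos_ge_zero) auto
  have T0: "0 \<le> ?T" using th tan_gt_zero[of "\<theta> / 2"] pi_gt_zero
    by (cases "\<theta> = 0") (auto simp: field_simps)
  have "?T\<^sup>2 = (sin \<theta>)\<^sup>2 / (1 + cos \<theta>)\<^sup>2"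
    using tan_half[of "\<theta> / 2"] by (simp add: power_divide add.commute)
  also have "(sin \<theta>)\<^sup>2 = (1 - cos \<theta>) * (1 + cos \<theta>)"
    by (simp add: sin_squared_eq algebra_simps power2_eq_square)
  finally have T: "?T\<^sup>2 * (1 + cos \<theta>) = 1 - cos \<theta>"
    using c by (simp add: power2_eq_square)
  have S: "2 * cos \<theta> * ((ip_norm ip a)\<^sup>2 + (ip_norm ip b)\<^sup>2) = cos \<theta> * (?P\<^sup>2 + ?Q\<^sup>2)"
    by (simp add: parallelogram)
  have eq: "(1 + cos \<theta>) * ((?T * ?P)\<^sup>2 - ?Q\<^sup>2) = ?P\<^sup>2 - ?Q\<^sup>2 - cos \<theta> * (?P\<^sup>2 + ?Q\<^sup>2)"
  proof -
    have "(1 + cos \<theta>) * ((?T * ?P)\<^sup>2 - ?Q\<^sup>2)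
        = (?T\<^sup>2 * (1 + cos \<theta>)) * ?P\<^sup>2 - (1 + cos \<theta>) * ?Q\<^sup>2"
      by (simp add: algebra_simps power_mult_distrib)
    then show ?thesis unfolding T by (simp add: algebra_simps)
  qed
  have nn: "0 \<le> ?T * ?P" "0 \<le> ?Q" using T0 ip_norm_nonneg by simp_all
  have "?T * ?P \<le> ?Q \<longleftrightarrow> (?T * ?P)\<^sup>2 - ?Q\<^sup>2 \<le> 0"
    using nn by (simp add: power2_le_iff_abs_le)
  also have "\<dots> \<longleftrightarrow> (1 + cos \<theta>) * ((?T * ?P)\<^sup>2 - ?Q\<^sup>2) \<le> 0"
    using c by (simp add: mult_le_0_iff)
  finally show "?T * ?P \<le> ?Q \<longleftrightarrow>
      ?P\<^sup>2 - ?Q\<^sup>2 \<le> 2 * cos \<theta> * ((ip_norm ip a)\<^sup>2 + (ip_norm ip b)\<^sup>2)"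
    unfolding eq S by auto
  have "?T * ?P = ?Q \<longleftrightarrow> (?T * ?P)\<^sup>2 - ?Q\<^sup>2 = 0"
    using nn by (simp add: power2_eq_iff_nonneg)
  also have "\<dots> \<longleftrightarrow> (1 + cos \<theta>) * ((?T * ?P)\<^sup>2 - ?Q\<^sup>2) = 0"
    using c by simp
  finally show "?T * ?P = ?Q \<longleftrightarrow>
      ?P\<^sup>2 - ?Q\<^sup>2 = 2 * cos \<theta> * ((ip_norm ip a)\<^sup>2 + (ip_norm ip b)\<^sup>2)"
    unfolding eq S by auto
qed

text \<open>
  The angle between \<open>a\<close> and \<open>b\<close> is given by \<open>cos \<theta> \<parallel>a\<parallel> \<parallel>b\<parallel> = |\<langle>a, b\<rangle>|\<close>, a relation that is
  preserved by scaling \<open>a\<close> and \<open>b\<close>.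
\<close>

lemma tan_half_le:
  assumes th: "0 \<le> \<theta>" "\<theta> \<le> pi / 2"
    and cos: "cos \<theta> * (ip_norm ip a * ip_norm ip b) = norm (ip a b)"
  shows "tan (\<theta> / 2) * ip_norm ip (a + b) \<le> ip_norm ip (a - b)"
proof -
  have c: "0 \<le> cos \<theta>" using th by (intro cos_ge_zero) auto
  have "4 * norm (ip a b) = 2 * cos \<theta> * (2 * ip_norm ip a * ip_norm ip b)"
    by (simp flip: cos)
  also have "\<dots> \<le> 2 * cos \<theta> * ((ip_norm ip a)\<^sup>2 + (ip_norm ip b)\<^sup>2)"
    using c by (intro mult_left_mono sum_squares_bound) simp
  finally show ?thesis
    unfolding tan_half_cmp(1)[OF th] using polarization_le(1)[of a b] by linarith
qed

lemma tan_half_eq_iff: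
  assumes th: "0 \<le> \<theta>" "\<theta> \<le> pi / 2"
    and cos: "cos \<theta> * (ip_norm ip a * ip_norm ip b) = norm (ip a b)"
    and norms: "ip_norm ip a = ip_norm ip b"
  shows "tan (\<theta> / 2) * ip_norm ip (a + b) = ip_norm ip (a - b)
    \<longleftrightarrow> ip a b = of_real (norm (ip a b))"
proof -
  have "2 * cos \<theta> * ((ip_norm ip a)\<^sup>2 + (ip_norm ip b)\<^sup>2) = 4 * norm (ip a b)"
    using cos by (simp add: norms power2_eq_square)
  then show ?thesis
    unfolding tan_half_cmp(2)[OF th] using polarization_le(2)[of a b] by (simp only:)
qed

lemma ip_norm_scale_unimodular:
  assumes "norm \<alpha> = 1" "0 < s"
  shows "ip_norm ip (scale (of_real s) (scale \<alpha> u)) = s * ip_norm ip u"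
  using assms by (simp only: ip_norm_scale ip_norm_unimodular abs_of_pos)

lemma cos_scaled:
  assumes "norm \<alpha> = 1" "0 < s" "0 < t"
    and "cos \<theta> * (ip_norm ip u * ip_norm ip v) = norm (ip u v)"
    and "a = scale (of_real s) (scale \<alpha> u)" "b = scale (of_real t) v"
  shows "cos \<theta> * (ip_norm ip a * ip_norm ip b) = norm (ip a b)"
proof -
  have "norm (ip a b) = s * t * norm (ip u v)"
    using assms(1-3) unfolding assms(5,6) ip_scale_left ip_scale_of_real_right
    by (simp add: norm_mult)
  then show ?thesis
    using assms(2,3) unfolding assms(5,6) ip_norm_scale_unimodular[OF assms(1,2)]
      ip_norm_scale[of t v]
    by (simp flip: assms(4))
qed

lemma ip_scaled_nonneg_iff:
  assumes "norm \<alpha> = 1" "0 < s" "0 < t"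
    and "a = scale (of_real s) (scale \<alpha> u)" "b = scale (of_real t) v"
  shows "ip a b = of_real (norm (ip a b)) \<longleftrightarrow> of_real (norm (ip u v)) = \<alpha> * ip u v"
proof -
  have ab: "ip a b = of_real (s * t) * (\<alpha> * ip u v)"
    unfolding assms(4,5) ip_scale_left ip_scale_of_real_right by simp
  have n: "of_real (norm (ip a b)) = (of_real (s * t) * of_real (norm (ip u v)) :: 'k)"
    unfolding ab using assms(1-3) by (simp add: norm_mult)
  show ?thesis unfolding n unfolding ab using assms(2,3) by auto
qed

lemma independent_pair_scaled:
  assumes "independent {u, v}" "u \<noteq> v" "c \<noteq> 0"
  shows "scale c u + scale d v \<noteq> 0" and "scale c u - scale d v \<noteq> 0"
proof -
  have ns: "u \<notin> span {v}" using assms(1,2) by (simp add: independent_insert)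
  have "scale c u \<noteq> scale e v" for e
  proof
    assume "scale c u = scale e v"
    then have "scale (inverse c) (scale c u) \<in> span {v}"
      by (simp add: span_scale span_base)
    then show False using ns assms(3) by simp
  qed
  from this[of d] this[of "- d"] show "scale c u + scale d v \<noteq> 0" "scale c u - scale d v \<noteq> 0"
    by (auto simp: eq_neg_iff_add_eq_0)
qed

end


section \<open>Comparison of two inner products\<close>

context two_inner_products
begin

lemma ratio_bounds:
  assumes "w \<noteq> 0"
  shows "0 \<le> ratio_inf ip1 ip2"
    and "ratio_inf ip1 ip2 \<le> ereal (ip_norm ip2 w / ip_norm ip1 w)"
    and "ereal (ip_norm ip2 w / ip_norm ip1 w) \<le> ratio_sup ip1 ip2"
  unfolding ratio_inf_def ratio_sup_def using assms
  by (auto intro!: INF_greatest INF_lower SUP_upper simp: I1.ip_norm_nonneg I2.ip_norm_nonneg)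

lemma mem_inf_set_iff:
  assumes "w \<noteq> 0"
  shows "w \<in> inf_set ip1 ip2 \<longleftrightarrow> ereal (ip_norm ip2 w / ip_norm ip1 w) = ratio_inf ip1 ip2"
  unfolding inf_set_def mem_Collect_eq by (rule ereal_eq_mult_iff[OF I1.ip_norm_pos[OF assms]])

lemma mem_sup_set_iff:
  assumes "w \<noteq> 0"
  shows "w \<in> sup_set ip1 ip2 \<longleftrightarrow> ereal (ip_norm ip2 w / ip_norm ip1 w) = ratio_sup ip1 ip2"
  unfolding sup_set_def mem_Collect_eq by (rule ereal_eq_mult_iff[OF I1.ip_norm_pos[OF assms]])

lemma norm_quotient_bounds:
  assumes "x \<noteq> 0" "y \<noteq> 0"
  defines "q \<equiv> (ip_norm ip2 y / ip_norm ip2 x) / (ip_norm ip1 y / ip_norm ip1 x)"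
  shows "ereal q \<le> ratio_sup ip1 ip2 / ratio_inf ip1 ip2"
    and "ereal q = ratio_sup ip1 ip2 / ratio_inf ip1 ip2
      \<longleftrightarrow> x \<in> inf_set ip1 ip2 \<and> y \<in> sup_set ip1 ip2"
    and "ratio_inf ip1 ip2 / ratio_sup ip1 ip2 \<le> ereal q"
    and "ratio_inf ip1 ip2 / ratio_sup ip1 ip2 = ereal q
      \<longleftrightarrow> y \<in> inf_set ip1 ip2 \<and> x \<in> sup_set ip1 ip2"
proof -
  let ?r = "ip_norm ip2 x / ip_norm ip1 x" and ?s = "ip_norm ip2 y / ip_norm ip1 y"
  have q: "q = ?s / ?r" unfolding q_def by simp
  have pos: "0 < ?r" "0 < ?s"
    using assms(1,2) by (simp_all add: I1.ip_norm_pos I2.ip_norm_pos)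
  note b = ereal_quotient_bounds[OF ratio_bounds(1)[OF assms(1)]
      ratio_bounds(2)[OF assms(1)] ratio_bounds(2)[OF assms(2)]
      ratio_bounds(3)[OF assms(1)] ratio_bounds(3)[OF assms(2)] pos]
  note mem = mem_inf_set_iff[OF assms(1)] mem_inf_set_iff[OF assms(2)]
    mem_sup_set_iff[OF assms(1)] mem_sup_set_iff[OF assms(2)]
  show "ereal q \<le> ratio_sup ip1 ip2 / ratio_inf ip1 ip2"
    and "ereal q = ratio_sup ip1 ip2 / ratio_inf ip1 ip2
      \<longleftrightarrow> x \<in> inf_set ip1 ip2 \<and> y \<in> sup_set ip1 ip2"
    and "ratio_inf ip1 ip2 / ratio_sup ip1 ip2 \<le> ereal q"
    and "ratio_inf ip1 ip2 / ratio_sup ip1 ip2 = ereal q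
      \<longleftrightarrow> y \<in> inf_set ip1 ip2 \<and> x \<in> sup_set ip1 ip2"
    unfolding q mem by (fact b)+
qed

text \<open>
  In the next two lemmas \<open>x\<close> and \<open>y\<close> stand for \<open>a + b\<close> and \<open>a - b\<close>, and \<open>T1\<close>, \<open>T2\<close> for the
  two half-angle tangents; the pair \<open>a\<close>, \<open>b\<close> is a minimizing one for the first inner product in
  the upper bound, and for the second in the lower bound.
\<close>

lemma tan_upper:
  assumes x: "x \<noteq> 0" and y: "y \<noteq> 0"
    and T1: "T1 * ip_norm ip1 x = ip_norm ip1 y"
    and T2: "T2 * ip_norm ip2 x \<le> ip_norm ip2 y"
  shows "ereal T2 \<le> ratio_sup ip1 ip2 / ratio_inf ip1 ip2 * ereal T1"
    and "ereal T2 = ratio_sup ip1 ip2 / ratio_inf ip1 ip2 * ereal T1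
      \<longleftrightarrow> x \<in> inf_set ip1 ip2 \<and> y \<in> sup_set ip1 ip2 \<and> T2 * ip_norm ip2 x = ip_norm ip2 y"
proof -
  note pos = I1.ip_norm_pos[OF x] I1.ip_norm_pos[OF y] I2.ip_norm_pos[OF x] I2.ip_norm_pos[OF y]
  have T1': "T1 = ip_norm ip1 y / ip_norm ip1 x" using T1 pos by (simp add: field_simps)
  have T1pos: "0 < T1" unfolding T1' using pos by simp
  let ?q = "(ip_norm ip2 y / ip_norm ip2 x) / T1"
  have q: "T2 / T1 \<le> ?q" using T2 T1pos pos by (simp add: field_simps)
  have q_eq: "T2 / T1 = ?q \<longleftrightarrow> T2 * ip_norm ip2 x = ip_norm ip2 y"
    using T1pos pos by (auto simp: field_simps)
  note b = norm_quotient_bounds(1,2)[OF x y, folded T1']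
  show "ereal T2 \<le> ratio_sup ip1 ip2 / ratio_inf ip1 ip2 * ereal T1"
    unfolding ereal_le_mult_iff[OF T1pos] using q b(1) by (metis ereal_less_eq(3) order_trans)
  have "ereal (T2 / T1) = ratio_sup ip1 ip2 / ratio_inf ip1 ip2
      \<longleftrightarrow> T2 / T1 = ?q \<and> ereal ?q = ratio_sup ip1 ip2 / ratio_inf ip1 ip2"
    using q b(1) by (metis antisym ereal_less_eq(3))
  then show "ereal T2 = ratio_sup ip1 ip2 / ratio_inf ip1 ip2 * ereal T1
      \<longleftrightarrow> x \<in> inf_set ip1 ip2 \<and> y \<in> sup_set ip1 ip2 \<and> T2 * ip_norm ip2 x = ip_norm ip2 y"
    unfolding ereal_eq_mult_iff[OF T1pos] q_eq b(2) by blast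
qed

lemma tan_lower:
  assumes x: "x \<noteq> 0" and y: "y \<noteq> 0" and T1pos: "0 < T1"
    and T1: "T1 * ip_norm ip1 x \<le> ip_norm ip1 y"
    and T2: "T2 * ip_norm ip2 x = ip_norm ip2 y"
  shows "ratio_inf ip1 ip2 / ratio_sup ip1 ip2 * ereal T1 \<le> ereal T2"
    and "ratio_inf ip1 ip2 / ratio_sup ip1 ip2 * ereal T1 = ereal T2
      \<longleftrightarrow> y \<in> inf_set ip1 ip2 \<and> x \<in> sup_set ip1 ip2 \<and> T1 * ip_norm ip1 x = ip_norm ip1 y"
proof -
  note pos = I1.ip_norm_pos[OF x] I1.ip_norm_pos[OF y] I2.ip_norm_pos[OF x] I2.ip_norm_pos[OF y]
  have T2': "T2 = ip_norm ip2 y / ip_norm ip2 x" using T2 pos by (simp add: field_simps)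
  have T2pos: "0 < T2" unfolding T2' using pos by simp
  let ?q = "T2 / (ip_norm ip1 y / ip_norm ip1 x)"
  have q: "?q \<le> T2 / T1" using T1 T1pos T2pos pos by (simp add: field_simps)
  have q_eq: "T2 / T1 = ?q \<longleftrightarrow> T1 * ip_norm ip1 x = ip_norm ip1 y"
    using T1pos T2pos pos by (auto simp: field_simps)
  note b = norm_quotient_bounds(3,4)[OF x y, folded T2']
  show "ratio_inf ip1 ip2 / ratio_sup ip1 ip2 * ereal T1 \<le> ereal T2"
    unfolding ereal_mult_le_iff[OF T1pos] using q b(1) by (metis ereal_less_eq(3) order_trans)
  have "ereal (T2 / T1) = ratio_inf ip1 ip2 / ratio_sup ip1 ip2
      \<longleftrightarrow> T2 / T1 = ?q \<and> ratio_inf ip1 ip2 / ratio_sup ip1 ip2 = ereal ?q"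
    using q b(1) by (metis antisym ereal_less_eq(3))
  then show "ratio_inf ip1 ip2 / ratio_sup ip1 ip2 * ereal T1 = ereal T2
      \<longleftrightarrow> y \<in> inf_set ip1 ip2 \<and> x \<in> sup_set ip1 ip2 \<and> T1 * ip_norm ip1 x = ip_norm ip1 y"
    unfolding eq_commute[of "_ * ereal T1"] ereal_eq_mult_iff[OF T1pos] q_eq b(2) by blast
qed

lemma inf_set_diff_normalized_eq:
  assumes "a - b \<in> inf_set ip1 ip2" "a \<noteq> 0"
  shows "ip_norm ip1 a = ip_norm ip1 b \<longleftrightarrow> ip_norm ip2 a = ip_norm ip2 b"
proof -
  have "ip_norm ip1 (- b) = ip_norm ip1 b" "ip_norm ip2 (- b) = ip_norm ip2 b"
    using I1.ip_norm_scale[of "- 1" b] I2.ip_norm_scale[of "- 1" b] by simp_all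
  then show ?thesis using inf_set_normalized_eq[of a "- b"] assms by simp
qed

context
  fixes u v :: 'v and \<Phi> \<Psi> :: real
  assumes uv: "u \<noteq> v" "I1.independent {u, v}"
    and Phi: "0 \<le> \<Phi>" "\<Phi> \<le> pi / 2"
    and Psi: "0 \<le> \<Psi>" "\<Psi> \<le> pi / 2"
    and cos1: "cos \<Phi> * (ip_norm ip1 u * ip_norm ip1 v) = norm (ip1 u v)"
    and cos2: "cos \<Psi> * (ip_norm ip2 u * ip_norm ip2 v) = norm (ip2 u v)"
begin

lemma uv_nonzero: "u \<noteq> 0" "v \<noteq> 0"
  using uv(2) I1.dependent_zero by blast+

lemma tan_half_upper:
  assumes al: "norm \<alpha> = 1" "of_real (norm (ip1 u v)) = \<alpha> * ip1 u v"
  shows "0 < tan (\<Phi> / 2)"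
    and "ereal (tan (\<Psi> / 2)) \<le> ratio_sup ip1 ip2 / ratio_inf ip1 ip2 * ereal (tan (\<Phi> / 2))"
    and "ereal (tan (\<Psi> / 2)) = ratio_sup ip1 ip2 / ratio_inf ip1 ip2 * ereal (tan (\<Phi> / 2))
      \<longleftrightarrow> (scale \<alpha> u, v) \<in> extremal_pairs scale ip1 ip2
        \<and> of_real (norm (ip2 u v)) = \<alpha> * ip2 u v"
proof -
  define s where "s = 1 / ip_norm ip1 u"
  define t where "t = 1 / ip_norm ip1 v"
  define a where "a = scale (of_real s) (scale \<alpha> u)"
  define b where "b = scale (of_real t) v"
  have st: "0 < s" "0 < t" using uv_nonzero by (simp_all add: s_def t_def I1.ip_norm_pos)
  have \<alpha>: "\<alpha> \<noteq> 0" using al(1) by auto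
  have n: "ip_norm ip1 a = 1" "ip_norm ip1 b = 1"
    unfolding a_def b_def I1.ip_norm_scale_unimodular[OF al(1) st(1)] I1.ip_norm_scale[of t v]
    using st uv_nonzero by (simp_all add: s_def t_def)
  have a0: "a \<noteq> 0" using n(1) I1.ip_norm_zero by auto
  have ne: "a + b \<noteq> 0" "a - b \<noteq> 0"
    using I1.independent_pair_scaled[OF uv(2,1), of "of_real s * \<alpha>" "of_real t"] \<alpha> st
    by (simp_all add: a_def b_def)
  note ang1 = I1.cos_scaled[OF al(1) st cos1 a_def b_def]
  note ang2 = I2.cos_scaled[OF al(1) st cos2 a_def b_def]
  have t1: "tan (\<Phi> / 2) * ip_norm ip1 (a + b) = ip_norm ip1 (a - b)"
    using I1.tan_half_eq_iff[OF Phi ang1] I1.ip_scaled_nonneg_iff[OF al(1) st a_def b_def] al(2) n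
    by simp
  then show "0 < tan (\<Phi> / 2)"
    using I1.ip_norm_pos[OF ne(1)] I1.ip_norm_pos[OF ne(2)] zero_less_mult_pos2 by metis
  note up = tan_upper[OF ne t1 I2.tan_half_le[OF Psi ang2]]
  show "ereal (tan (\<Psi> / 2)) \<le> ratio_sup ip1 ip2 / ratio_inf ip1 ip2 * ereal (tan (\<Phi> / 2))"
    by (fact up(1))
  have E: "(scale \<alpha> u, v) \<in> extremal_pairs scale ip1 ip2
      \<longleftrightarrow> a + b \<in> inf_set ip1 ip2 \<and> a - b \<in> sup_set ip1 ip2"
    using uv_nonzero \<alpha>
    by (simp add: extremal_pairs_def extremal_pairs_wrt_def ip_normalize_def a_def b_def s_def t_def
        I1.ip_norm_unimodular[OF al(1)] del: I1.scale_scale)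
  have "tan (\<Psi> / 2) * ip_norm ip2 (a + b) = ip_norm ip2 (a - b)
      \<longleftrightarrow> of_real (norm (ip2 u v)) = \<alpha> * ip2 u v" if "a + b \<in> inf_set ip1 ip2"
  proof -
    have "ip_norm ip2 a = ip_norm ip2 b" using inf_set_normalized_eq[OF that a0] n by simp
    then show ?thesis
      using I2.tan_half_eq_iff[OF Psi ang2] I2.ip_scaled_nonneg_iff[OF al(1) st a_def b_def] by simp
  qed
  then show "ereal (tan (\<Psi> / 2)) = ratio_sup ip1 ip2 / ratio_inf ip1 ip2 * ereal (tan (\<Phi> / 2))
      \<longleftrightarrow> (scale \<alpha> u, v) \<in> extremal_pairs scale ip1 ip2
        \<and> of_real (norm (ip2 u v)) = \<alpha> * ip2 u v"
    unfolding up(2) E by blast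
qed

text \<open>
  The pair is now normalized in the second inner product, so that membership in \<open>E\<close> is read
  through \<open>E = E\<^sub>2\<close>; the sign of \<open>v\<close> exchanges the roles of \<open>a + b\<close> and \<open>a - b\<close>.
\<close>

lemma tan_half_lower:
  assumes al: "norm \<alpha> = 1" "of_real (norm (ip2 u v)) = \<alpha> * ip2 u v"
    and pos: "0 < tan (\<Phi> / 2)"
  shows "ratio_inf ip1 ip2 / ratio_sup ip1 ip2 * ereal (tan (\<Phi> / 2)) \<le> ereal (tan (\<Psi> / 2))"
    and "ratio_inf ip1 ip2 / ratio_sup ip1 ip2 * ereal (tan (\<Phi> / 2)) = ereal (tan (\<Psi> / 2))
      \<longleftrightarrow> (scale \<alpha> u, - v) \<in> extremal_pairs scale ip1 ip2
        \<and> of_real (norm (ip1 u v)) = \<alpha> * ip1 u v"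
proof -
  define s where "s = 1 / ip_norm ip2 u"
  define t where "t = 1 / ip_norm ip2 v"
  define a where "a = scale (of_real s) (scale \<alpha> u)"
  define b where "b = scale (of_real t) v"
  have st: "0 < s" "0 < t" using uv_nonzero by (simp_all add: s_def t_def I2.ip_norm_pos)
  have \<alpha>: "\<alpha> \<noteq> 0" using al(1) by auto
  have n: "ip_norm ip2 a = 1" "ip_norm ip2 b = 1"
    unfolding a_def b_def I2.ip_norm_scale_unimodular[OF al(1) st(1)] I2.ip_norm_scale[of t v]
    using st uv_nonzero by (simp_all add: s_def t_def)
  have a0: "a \<noteq> 0" using n(1) I2.ip_norm_zero by auto
  have ne: "a + b \<noteq> 0" "a - b \<noteq> 0"
    using I1.independent_pair_scaled[OF uv(2,1), of "of_real s * \<alpha>" "of_real t"] \<alpha> st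
    by (simp_all add: a_def b_def)
  note ang1 = I1.cos_scaled[OF al(1) st cos1 a_def b_def]
  note ang2 = I2.cos_scaled[OF al(1) st cos2 a_def b_def]
  have t2: "tan (\<Psi> / 2) * ip_norm ip2 (a + b) = ip_norm ip2 (a - b)"
    using I2.tan_half_eq_iff[OF Psi ang2] I2.ip_scaled_nonneg_iff[OF al(1) st a_def b_def] al(2) n
    by simp
  note low = tan_lower[OF ne pos I1.tan_half_le[OF Phi ang1] t2]
  show "ratio_inf ip1 ip2 / ratio_sup ip1 ip2 * ereal (tan (\<Phi> / 2)) \<le> ereal (tan (\<Psi> / 2))"
    by (fact low(1))
  have neg: "ip_norm ip2 (- v) = ip_norm ip2 v"
    using I2.ip_norm_scale[of "- 1" v] by simp
  have E: "(scale \<alpha> u, - v) \<in> extremal_pairs scale ip1 ip2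
      \<longleftrightarrow> a - b \<in> inf_set ip1 ip2 \<and> a + b \<in> sup_set ip1 ip2"
    using uv_nonzero \<alpha>
    by (simp add: extremal_pairs_eq_wrt_ip2 extremal_pairs_wrt_def ip_normalize_def a_def b_def
        s_def t_def I2.ip_norm_unimodular[OF al(1)] neg del: I1.scale_scale)
  have "tan (\<Phi> / 2) * ip_norm ip1 (a + b) = ip_norm ip1 (a - b)
      \<longleftrightarrow> of_real (norm (ip1 u v)) = \<alpha> * ip1 u v" if "a - b \<in> inf_set ip1 ip2"
  proof -
    have "ip_norm ip1 a = ip_norm ip1 b" using inf_set_diff_normalized_eq[OF that a0] n by simp
    then show ?thesis
      using I1.tan_half_eq_iff[OF Phi ang1] I1.ip_scaled_nonneg_iff[OF al(1) st a_def b_def] by simp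
  qed
  then show "ratio_inf ip1 ip2 / ratio_sup ip1 ip2 * ereal (tan (\<Phi> / 2)) = ereal (tan (\<Psi> / 2))
      \<longleftrightarrow> (scale \<alpha> u, - v) \<in> extremal_pairs scale ip1 ip2
        \<and> of_real (norm (ip1 u v)) = \<alpha> * ip1 u v"
    unfolding low(2) E by blast
qed

end

end

lemma eq_mult_iff_unimodular_eq:
  fixes x :: "'k::real_or_complex"
  assumes "of_real (norm x) = \<beta> * x"
  shows "of_real (norm x) = \<alpha> * x \<longleftrightarrow> \<alpha> = \<beta> \<or> x = 0"
  unfolding assms by auto

theorem theorem2p6:
  fixes scale :: "'k::real_or_complex \<Rightarrow> 'v::ab_group_add \<Rightarrow> 'v"
    and ip1 ip2 :: "'v \<Rightarrow> 'v \<Rightarrow> 'k"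
    and u v :: 'v
    and \<Phi> \<Psi> :: real
  assumes "two_inner_products scale ip1 ip2"
    and "\<exists>w::'v. w \<noteq> 0"
    and "u \<noteq> v" and "\<not> module.dependent scale {u, v}"
    and "0 \<le> \<Phi>" and "\<Phi> \<le> pi / 2"
    and "0 \<le> \<Psi>" and "\<Psi> \<le> pi / 2"
    and "cos \<Phi> = norm (ip1 u v) / (ip_norm ip1 u * ip_norm ip1 v)"
    and "cos \<Psi> = norm (ip2 u v) / (ip_norm ip2 u * ip_norm ip2 v)"
  shows "ratio_inf ip1 ip2 / ratio_sup ip1 ip2 * ereal (tan (\<Phi> / 2)) \<le> ereal (tan (\<Psi> / 2))
    \<and> ereal (tan (\<Psi> / 2)) \<le> ratio_sup ip1 ip2 / ratio_inf ip1 ip2 * ereal (tan (\<Phi> / 2))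
    \<and> (\<forall>\<alpha>1 \<alpha>2 :: 'k.
        norm \<alpha>1 = 1 \<longrightarrow> norm \<alpha>2 = 1 \<longrightarrow>
        of_real (norm (ip1 u v)) = \<alpha>1 * ip1 u v \<longrightarrow>
        of_real (norm (ip2 u v)) = \<alpha>2 * ip2 u v \<longrightarrow>
          (ereal (tan (\<Psi> / 2)) = ratio_sup ip1 ip2 / ratio_inf ip1 ip2 * ereal (tan (\<Phi> / 2))
             \<longleftrightarrow> (scale \<alpha>1 u, v) \<in> extremal_pairs scale ip1 ip2 \<and> (\<alpha>1 = \<alpha>2 \<or> ip2 u v = 0))
        \<and> (ratio_inf ip1 ip2 / ratio_sup ip1 ip2 * ereal (tan (\<Phi> / 2)) = ereal (tan (\<Psi> / 2))
             \<longleftrightarrow> (scale \<alpha>2 u, - v) \<in> extremal_pairs scale ip1 ip2 \<and> (\<alpha>1 = \<alpha>2 \<or> ip1 u v = 0)))"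
proof -
  interpret two_inner_products scale ip1 ip2 by fact
  have indep: "I1.independent {u, v}" using assms(4) .
  have nz: "u \<noteq> 0" "v \<noteq> 0"
    using indep I1.dependent_zero by blast+
  have cos: "cos \<Phi> * (ip_norm ip1 u * ip_norm ip1 v) = norm (ip1 u v)"
    "cos \<Psi> * (ip_norm ip2 u * ip_norm ip2 v) = norm (ip2 u v)"
    using I1.ip_norm_pos[OF nz(1)] I1.ip_norm_pos[OF nz(2)] I2.ip_norm_pos[OF nz(1)]
      I2.ip_norm_pos[OF nz(2)] by (simp_all add: assms(9,10))
  note upper = tan_half_upper[OF assms(3) indep assms(5-8) cos]
  note lower = tan_half_lower[OF assms(3) indep assms(5-8) cos]
  obtain \<beta>1 where \<beta>1: "norm \<beta>1 = 1" "of_real (norm (ip1 u v)) = \<beta>1 * ip1 u v"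
    by (rule ex_unimodular_align)
  obtain \<beta>2 where \<beta>2: "norm \<beta>2 = 1" "of_real (norm (ip2 u v)) = \<beta>2 * ip2 u v"
    by (rule ex_unimodular_align)
  note pos = upper(1)[OF \<beta>1]
  show ?thesis
  proof (intro conjI allI impI)
    show "ratio_inf ip1 ip2 / ratio_sup ip1 ip2 * ereal (tan (\<Phi> / 2)) \<le> ereal (tan (\<Psi> / 2))"
      by (rule lower(1)[OF \<beta>2 pos])
    show "ereal (tan (\<Psi> / 2)) \<le> ratio_sup ip1 ip2 / ratio_inf ip1 ip2 * ereal (tan (\<Phi> / 2))"
      by (rule upper(2)[OF \<beta>1])
  next
    fix \<alpha>1 \<alpha>2 :: 'k
    assume \<alpha>: "norm \<alpha>1 = 1" "norm \<alpha>2 = 1" "of_real (norm (ip1 u v)) = \<alpha>1 * ip1 u v"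
      "of_real (norm (ip2 u v)) = \<alpha>2 * ip2 u v"
    show "ereal (tan (\<Psi> / 2)) = ratio_sup ip1 ip2 / ratio_inf ip1 ip2 * ereal (tan (\<Phi> / 2))
        \<longleftrightarrow> (scale \<alpha>1 u, v) \<in> extremal_pairs scale ip1 ip2 \<and> (\<alpha>1 = \<alpha>2 \<or> ip2 u v = 0)"
      unfolding upper(3)[OF \<alpha>(1,3)] eq_mult_iff_unimodular_eq[OF \<alpha>(4)] ..
    show "ratio_inf ip1 ip2 / ratio_sup ip1 ip2 * ereal (tan (\<Phi> / 2)) = ereal (tan (\<Psi> / 2))
        \<longleftrightarrow> (scale \<alpha>2 u, - v) \<in> extremal_pairs scale ip1 ip2 \<and> (\<alpha>1 = \<alpha>2 \<or> ip1 u v = 0)"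
      unfolding lower(2)[OF \<alpha>(2,4) pos] eq_mult_iff_unimodular_eq[OF \<alpha>(3)]
      by (simp only: eq_commute[of \<alpha>2])
  qed
qed

end
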